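(* Let $(\mathbb V,\partial)$ be a differential algebra. The definition of a double Poisson vertex algebra structure on $(\mathbb V,\partial)$ via a double $\lambda$-bracket (Definition I) and the definition via double products (Definition II) are equivalent: the formulas $$\{\!\{a_\lambda b\}\!\}=\sum_{n\ge0}\frac{\lambda^n}{n!}\,a_{(\!(n)\!)}b,\qquad a_{(\!(n)\!)}b=n!\cdot\big(\text{coefficient of }\lambda^n\text{ in }\{\!\{a_\lambda b\}\!\}\big)$$ give mutually inverse bijections between structures in the sense of Definition I and structures in the sense of Definition II.
   Context: $\Bbbk$ is a field of characteristic $0$, $\otimes=\otimes_\Bbbk$; a differential algebra is a unital associative $\Bbbk$-algebra with a derivation $\partial$, extended to tensor powers by $\partial(a_1\otimes\cdots\otimes a_n)=\sum_ia_1\otimes\cdots\otimes\partial a_i\otimes\cdots\otimes a_n$. For $d=d'\otimes d''$ (sums omitted): $d^\sigma=d''\otimes d'$, $b\,d\,c=bd'\otimes d''c$, $b*_1d*_1c=d'c\otimes bd''$, $d\otimes_1c=d'\otimes c\otimes d''$. Definition I. A linear map $\{\!\{-_\lambda-\}\!\}:\mathbb V\otimes\mathbb V\to(\mathbb V\otimes\mathbb V)[\lambda]$ such that for all $a,b,c\in\mathbb V$: (1) $\{\!\{\partial a_\lambda b\}\!\}=-\lambda\{\!\{a_\lambda b\}\!\}$, $\{\!\{a_\lambda\partial b\}\!\}=(\partial+\lambda)\{\!\{a_\lambda b\}\!\}$; (2) $\{\!\{a_\lambda bc\}\!\}=\{\!\{a_\lambda b\}\!\}c+b\{\!\{a_\lambda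 c\}\!\}$; (3) if $\{\!\{a_\lambda c\}\!\}=\sum p_n\lambda^n$, $\{\!\{b_\lambda c\}\!\}=\sum q_n\lambda^n$, then $\{\!\{ab_\lambda c\}\!\}=\sum_n\sum_{k=0}^n\binom nk\lambda^{n-k}(p_n*_1\partial^k(b)+\partial^k(a)*_1q_n)$; (4) if $\{\!\{b_\lambda a\}\!\}=\sum r_n\lambda^n$ then $\{\!\{a_\lambda b\}\!\}=-\sum_n(-\lambda-\partial)^n(r_n^\sigma)$; (5) $\{\!\{a_\lambda\{\!\{b_\mu c\}\!\}\}\!\}_L-\{\!\{b_\mu\{\!\{a_\lambda c\}\!\}\}\!\}_R-\{\!\{\{\!\{a_\lambda b\}\!\}_{\lambda+\mu}c\}\!\}_L=0$, where $\{\!\{a_\lambda b'\otimes b''\}\!\}_L=\{\!\{a_\lambda b'\}\!\}\otimes b''$, $\{\!\{a_\lambda b'\otimes b''\}\!\}_R=b'\otimes\{\!\{a_\lambda b''\}\!\}$, $\{\!\{a'\otimes a''{}_\lambda b\}\!\}_L=\sum_n\sum_k\binom nk\lambda^{n-k}s_n\otimes_1\partial^k(a'')$ if $\{\!\{a'_\lambda b\}\!\}=\sum s_n\lambda^n$. Definition II. $\Bbbk$-bilinear maps $\mathbb V\times\mathbb V\to\mathbb V\otimes\mathbb V$, $(a,b)\mapsto a_{(\!(n)\!)}b$, $n\in\mathbb Z_{\ge0}$, such that for fixed $a,b$, $a_{(\!(n)\!)}b=0$ for $n$ large, and for all $a,b,c\in\mathbb V$, $m,n\ge0$: (1') $(\partial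 a)_{(\!(n)\!)}b=-n\,a_{(\!(n-1)\!)}b$, $a_{(\!(n)\!)}(\partial b)=\partial(a_{(\!(n)\!)}b)+n\,a_{(\!(n-1)\!)}b$; (2') $a_{(\!(n)\!)}b=\sum_{i\ge0}\frac{(-1)^{n+i+1}}{i!}\partial^i(b_{(\!(n+i)\!)}a)^\sigma$; (3') $a_{(\!(m;L)\!)}b_{(\!(n)\!)}c-b_{(\!(n;R)\!)}a_{(\!(m)\!)}c=\sum_{i=0}^m\binom mi(a_{(\!(i)\!)}b)_{(\!(m+n-i;L)\!)}c$, where $a_{(\!(n;L)\!)}(b'\otimes b'')=a_{(\!(n)\!)}b'\otimes b''$, $a_{(\!(n;R)\!)}(b'\otimes b'')=b'\otimes a_{(\!(n)\!)}b''$, $(a'\otimes a'')_{(\!(n;L)\!)}b=\sum_{j\ge0}\frac1{j!}(a'_{(\!(n+j)\!)}b)\otimes_1\partial^j(a'')$; (4') $a_{(\!(n)\!)}bc=(a_{(\!(n)\!)}b)c+b(a_{(\!(n)\!)}c)$; (5') $(ab)_{(\!(n)\!)}c=\sum_{i\ge0}\frac1{i!}\partial^i(a)*_1(b_{(\!(n+i)\!)}c)+\sum_{i\ge0}\frac1{i!}(a_{(\!(n+i)\!)}c)*_1\partial^i(b)$. *)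

theory Defs
  imports "HOL-Library.Poly_Mapping" "HOL-Computational_Algebra.Polynomial"
begin

section \<open>Tensor products of vector spaces\<close>

text \<open>
  A type cannot depend on the scalar multiplication \<open>sA\<close>, \<open>sB\<close>. So the tensor product is a
  type \<open>'t\<close> together with a map \<open>tens\<close> that presents it as the textbook quotient: the free
  vector space on the pairs \<open>(a, b)\<close> maps onto \<open>'t\<close> by sending the generator \<open>(a, b)\<close> to
  \<open>tens a b\<close>, and the kernel is exactly the span of the bilinearity relations.
  The universal property is derived below (\<open>tensor_lift\<close>).
\<close>

definition free_scale :: "'k::field \<Rightarrow> ('x \<Rightarrow>\<^sub>0 'k) \<Rightarrow> ('x \<Rightarrow>\<^sub>0 'k)" where
  "free_scale c p = Poly_Mapping.map ((*) c) p"

definition free_extend ::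
  "('k::field \<Rightarrow> 't::ab_group_add \<Rightarrow> 't) \<Rightarrow> ('x \<Rightarrow> 't) \<Rightarrow> ('x \<Rightarrow>\<^sub>0 'k) \<Rightarrow> 't" where
  "free_extend sT f p = (\<Sum>x\<in>Poly_Mapping.keys p. sT (Poly_Mapping.lookup p x) (f x))"

definition bilinear_relations ::
  "('k::field \<Rightarrow> 'a::ab_group_add \<Rightarrow> 'a) \<Rightarrow> ('k \<Rightarrow> 'b::ab_group_add \<Rightarrow> 'b)
    \<Rightarrow> ('a \<times> 'b \<Rightarrow>\<^sub>0 'k) set" where
  "bilinear_relations sA sB =
     {Poly_Mapping.single (a + a', b) 1 - Poly_Mapping.single (a, b) 1
        - Poly_Mapping.single (a', b) 1 | a a' b. True}
   \<union> {Poly_Mapping.single (a, b + b') 1 - Poly_Mapping.single (a, b) 1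
        - Poly_Mapping.single (a, b') 1 | a b b'. True}
   \<union> {Poly_Mapping.single (sA c a, b) 1 - Poly_Mapping.single (a, b) c | c a b. True}
   \<union> {Poly_Mapping.single (a, sB c b) 1 - Poly_Mapping.single (a, b) c | c a b. True}"

locale tensor_product =
  A: vector_space sA + B: vector_space sB + T: vector_space sT
  for sA :: "'k::field \<Rightarrow> 'a::ab_group_add \<Rightarrow> 'a"
    and sB :: "'k \<Rightarrow> 'b::ab_group_add \<Rightarrow> 'b"
    and sT :: "'k \<Rightarrow> 't::ab_group_add \<Rightarrow> 't"
    and tens :: "'a \<Rightarrow> 'b \<Rightarrow> 't" +
  assumes surj_free: "surj (free_extend sT (\<lambda>(a, b). tens a b))"
    and kernel_free: "{p. free_extend sT (\<lambda>(a, b). tens a b) p = 0}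
                        = module.span free_scale (bilinear_relations sA sB)"

definition bilinear_map ::
  "('k::field \<Rightarrow> 'a::ab_group_add \<Rightarrow> 'a) \<Rightarrow> ('k \<Rightarrow> 'b::ab_group_add \<Rightarrow> 'b)
    \<Rightarrow> ('k \<Rightarrow> 'w::ab_group_add \<Rightarrow> 'w) \<Rightarrow> ('a \<Rightarrow> 'b \<Rightarrow> 'w) \<Rightarrow> bool" where
  "bilinear_map sA sB sW f \<longleftrightarrow>
     (\<forall>b. Vector_Spaces.linear sA sW (\<lambda>a. f a b)) \<and> (\<forall>a. Vector_Spaces.linear sB sW (f a))"

definition tensor_lift ::
  "('k::field \<Rightarrow> 't::ab_group_add \<Rightarrow> 't) \<Rightarrow> ('a \<Rightarrow> 'b \<Rightarrow> 't) \<Rightarrow> ('k \<Rightarrow> 'w::ab_group_add \<Rightarrow> 'w)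
    \<Rightarrow> ('a \<Rightarrow> 'b \<Rightarrow> 'w) \<Rightarrow> 't \<Rightarrow> 'w" where
  "tensor_lift sT tens sW f =
     (THE g. Vector_Spaces.linear sT sW g \<and> (\<forall>a b. g (tens a b) = f a b))"


subsection \<open>The universal property\<close>

lemma lookup_free_scale:
  "Poly_Mapping.lookup (free_scale c p) x = c * Poly_Mapping.lookup p x"
  by (auto simp: free_scale_def Poly_Mapping.map.rep_eq when_def)

lemma vector_space_free: "vector_space (free_scale :: 'k::field \<Rightarrow> ('x \<Rightarrow>\<^sub>0 'k) \<Rightarrow> _)"
  by unfold_locales
    (auto intro!: poly_mapping_eqI simp: lookup_free_scale lookup_add algebra_simps)

lemma free_extend_superset:
  assumes "vector_space sT" "finite S" "Poly_Mapping.keys p \<subseteq> S"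
  shows "free_extend sT f p = (\<Sum>x\<in>S. sT (Poly_Mapping.lookup p x) (f x))"
proof -
  interpret vector_space sT by fact
  show ?thesis unfolding free_extend_def
    by (rule sum.mono_neutral_left) (use assms in \<open>auto simp: in_keys_iff\<close>)
qed

lemma linear_free_extend:
  fixes sT :: "'k::field \<Rightarrow> 't::ab_group_add \<Rightarrow> 't" and f :: "'x \<Rightarrow> 't"
  assumes "vector_space sT"
  shows "Vector_Spaces.linear free_scale sT (free_extend sT f)"
proof -
  interpret vector_space sT by fact
  interpret F: vector_space "free_scale :: 'k \<Rightarrow> ('x \<Rightarrow>\<^sub>0 'k) \<Rightarrow> _" by (rule vector_space_free)
  show ?thesis
  proof unfold_locales
    fix p q :: "'x \<Rightarrow>\<^sub>0 'k"
    let ?S = "Poly_Mapping.keys p \<union> Poly_Mapping.keys q"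
    have "free_extend sT f (p + q) = (\<Sum>x\<in>?S. sT (Poly_Mapping.lookup (p + q) x) (f x))"
      by (rule free_extend_superset) (use assms keys_add[of p q] in auto)
    also have "\<dots> = (\<Sum>x\<in>?S. sT (Poly_Mapping.lookup p x) (f x))
                   + (\<Sum>x\<in>?S. sT (Poly_Mapping.lookup q x) (f x))"
      by (simp add: lookup_add scale_left_distrib sum.distrib)
    also have "\<dots> = free_extend sT f p + free_extend sT f q"
      by (intro arg_cong2[where f = "(+)"] free_extend_superset[symmetric]) (use assms in auto)
    finally show "free_extend sT f (p + q) = free_extend sT f p + free_extend sT f q" .
  next
    fix c and p :: "'x \<Rightarrow>\<^sub>0 'k"
    have "free_extend sT f (free_scale c p)
        = (\<Sum>x\<in>Poly_Mapping.keys p. sT (Poly_Mapping.lookup (free_scale c p) x) (f x))"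
      by (rule free_extend_superset) (use assms in \<open>auto simp: in_keys_iff lookup_free_scale\<close>)
    then show "free_extend sT f (free_scale c p) = sT c (free_extend sT f p)"
      by (simp add: lookup_free_scale free_extend_def scale_sum_right)
  qed
qed

lemma free_extend_single:
  assumes "vector_space sT"
  shows "free_extend sT f (Poly_Mapping.single x c) = sT c (f x)"
proof -
  interpret vector_space sT by fact
  show ?thesis by (simp add: free_extend_def)
qed

lemma free_extend_relations:
  assumes W: "vector_space sW" and f: "bilinear_map sA sB sW f"
    and p: "p \<in> module.span free_scale (bilinear_relations sA sB)"
  shows "free_extend sW (\<lambda>(a, b). f a b) p = 0"
proof -
  interpret L: Vector_Spaces.linear free_scale sW "free_extend sW (\<lambda>(a, b). f a b)"
    by (rule linear_free_extend[OF W])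
  have f1: "f (a + a') b = f a b + f a' b" "f (sA c a) b = sW c (f a b)"
    "f a (b + b') = f a b + f a b'" "f a (sB c b) = sW c (f a b)" for a a' b b' c
  proof -
    interpret l: Vector_Spaces.linear sA sW "\<lambda>a. f a b"
      using f by (simp add: bilinear_map_def)
    interpret r: Vector_Spaces.linear sB sW "f a"
      using f by (simp add: bilinear_map_def)
    show "f (a + a') b = f a b + f a' b" "f (sA c a) b = sW c (f a b)"
      "f a (b + b') = f a b + f a b'" "f a (sB c b) = sW c (f a b)"
      by (fact l.add l.scale r.add r.scale)+
  qed
  have "free_extend sW (\<lambda>(a, b). f a b) q = 0" if "q \<in> bilinear_relations sA sB" for q
    using that by (auto simp: bilinear_relations_def L.diff free_extend_single[OF W] f1)
  then show ?thesis
    using p by (rule L.eq_0_on_span)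
qed

context tensor_product
begin

lemma free_extend_zero_iff:
  "free_extend sT (\<lambda>(a, b). tens a b) p = 0
     \<longleftrightarrow> p \<in> module.span free_scale (bilinear_relations sA sB)"
  using kernel_free by blast

lemma bilinear_tens: "bilinear_map sA sB sT tens"
proof -
  interpret F: vector_space "free_scale :: 'k \<Rightarrow> ('a \<times> 'b \<Rightarrow>\<^sub>0 'k) \<Rightarrow> _"
    by (rule vector_space_free)
  interpret L: Vector_Spaces.linear free_scale sT "free_extend sT (\<lambda>(a, b). tens a b)"
    by (rule linear_free_extend) unfold_locales
  note single = free_extend_single[OF T.vector_space_axioms]
  have z: "free_extend sT (\<lambda>(a, b). tens a b) q = 0" if "q \<in> bilinear_relations sA sB" for q
    using that free_extend_zero_iff F.span_base by blast
  have "tens (a + a') b = tens a b + tens a' b" for a a' b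
  proof -
    have "Poly_Mapping.single (a + a', b) 1 - Poly_Mapping.single (a, b) 1
        - Poly_Mapping.single (a', b) 1 \<in> bilinear_relations sA sB"
      unfolding bilinear_relations_def by blast
    from z[OF this] show ?thesis by (simp add: L.diff single diff_eq_eq add.commute)
  qed
  moreover have "tens a (b + b') = tens a b + tens a b'" for a b b'
  proof -
    have "Poly_Mapping.single (a, b + b') 1 - Poly_Mapping.single (a, b) 1
        - Poly_Mapping.single (a, b') 1 \<in> bilinear_relations sA sB"
      unfolding bilinear_relations_def by blast
    from z[OF this] show ?thesis by (simp add: L.diff single diff_eq_eq add.commute)
  qed
  moreover have "tens (sA c a) b = sT c (tens a b)" for c a b
  proof -
    have "Poly_Mapping.single (sA c a, b) 1 - Poly_Mapping.single (a, b) c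
        \<in> bilinear_relations sA sB"
      unfolding bilinear_relations_def by blast
    from z[OF this] show ?thesis by (simp add: L.diff single)
  qed
  moreover have "tens a (sB c b) = sT c (tens a b)" for c a b
  proof -
    have "Poly_Mapping.single (a, sB c b) 1 - Poly_Mapping.single (a, b) c
        \<in> bilinear_relations sA sB"
      unfolding bilinear_relations_def by blast
    from z[OF this] show ?thesis by (simp add: L.diff single)
  qed
  ultimately show ?thesis
    unfolding bilinear_map_def by (intro conjI allI; unfold_locales) auto
qed

lemma linear_free_extend_tens:
  assumes "Vector_Spaces.linear sT sW g"
  shows "g (free_extend sT (\<lambda>(a, b). tens a b) p) = free_extend sW (\<lambda>(a, b). g (tens a b)) p"
proof -
  interpret G: Vector_Spaces.linear sT sW g by fact
  show ?thesis
    by (simp add: free_extend_def G.sum G.scale case_prod_unfold)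
qed

lemma universal_property:
  assumes W: "vector_space sW" and f: "bilinear_map sA sB sW f"
  shows "\<exists>!g. Vector_Spaces.linear sT sW g \<and> (\<forall>a b. g (tens a b) = f a b)"
proof (rule ex_ex1I)
  let ?e = "free_extend sT (\<lambda>(a, b). tens a b)" and ?F = "free_extend sW (\<lambda>(a, b). f a b)"
  interpret W: vector_space sW by fact
  interpret E: Vector_Spaces.linear free_scale sT ?e
    by (rule linear_free_extend) unfold_locales
  interpret F: Vector_Spaces.linear free_scale sW ?F
    by (rule linear_free_extend[OF W])
  define r where "r t = (SOME p. ?e p = t)" for t
  have r: "?e (r t) = t" for t
    unfolding r_def by (rule someI_ex) (metis surj_free surjD)
  have F_eq: "?F p = ?F q" if "?e p = ?e q" for p q
  proof -
    have "?e (p - q) = 0" using that by (simp add: E.diff)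
    then have "?F (p - q) = 0"
      using free_extend_relations[OF W f] free_extend_zero_iff by blast
    then show ?thesis by (simp add: F.diff)
  qed
  have "Vector_Spaces.linear sT sW (\<lambda>t. ?F (r t))"
  proof unfold_locales
    show "?F (r (x + y)) = ?F (r x) + ?F (r y)" for x y
      unfolding F.add[symmetric] by (rule F_eq) (simp add: r E.add)
    show "?F (r (sT c x)) = sW c (?F (r x))" for c x
      unfolding F.scale[symmetric] by (rule F_eq) (simp add: r E.scale)
  qed
  moreover have "?F (r (tens a b)) = f a b" for a b
  proof -
    have "?F (r (tens a b)) = ?F (Poly_Mapping.single (a, b) 1)"
      by (rule F_eq) (simp add: r free_extend_single[OF T.vector_space_axioms])
    then show ?thesis by (simp add: free_extend_single[OF W])
  qed
  ultimately show "\<exists>g. Vector_Spaces.linear sT sW g \<and> (\<forall>a b. g (tens a b) = f a b)"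
    by blast
next
  fix g h
  assume g: "Vector_Spaces.linear sT sW g \<and> (\<forall>a b. g (tens a b) = f a b)"
    and h: "Vector_Spaces.linear sT sW h \<and> (\<forall>a b. h (tens a b) = f a b)"
  show "g = h"
  proof
    fix t
    obtain p where "t = free_extend sT (\<lambda>(a, b). tens a b) p" using surj_free by (meson surjD)
    then show "g t = h t"
      using g h linear_free_extend_tens[of sW g p] linear_free_extend_tens[of sW h p] by simp
  qed
qed

lemma
  assumes "vector_space sW" "bilinear_map sA sB sW f"
  shows linear_tensor_lift: "Vector_Spaces.linear sT sW (tensor_lift sT tens sW f)"
    and tensor_lift_tens: "tensor_lift sT tens sW f (tens a b) = f a b"
  using theI'[OF universal_property[OF assms]] unfolding tensor_lift_def by blast+

end


section \<open>Differential algebras\<close>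

text \<open>The sort \<open>{ring, monoid_mult}\<close> is that of unital rings including the zero ring.\<close>

locale differential_algebra = vector_space scale
  for scale :: "'k::field_char_0 \<Rightarrow> 'v::{ring,monoid_mult} \<Rightarrow> 'v"
    and D :: "'v \<Rightarrow> 'v" +
  assumes scale_mult_left: "scale c (a * b) = scale c a * b"
    and scale_mult_right: "scale c (a * b) = a * scale c b"
    and linear_D: "Vector_Spaces.linear scale scale D"
    and D_mult: "D (a * b) = D a * b + a * D b"

text \<open>\<open>'t2\<close> is \<open>V \<otimes> V\<close> and \<open>'t3\<close> is \<open>V \<otimes> V \<otimes> V = (V \<otimes> V) \<otimes> V\<close>.\<close>

locale differential_algebra_tensors =
  differential_algebra scale D
  + T2: tensor_product scale scale scale2 tens
  + T3: tensor_product scale2 scale scale3 tens3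
  for scale :: "'k::field_char_0 \<Rightarrow> 'v::{ring,monoid_mult} \<Rightarrow> 'v"
    and D :: "'v \<Rightarrow> 'v"
    and scale2 :: "'k \<Rightarrow> 't2::ab_group_add \<Rightarrow> 't2"
    and tens :: "'v \<Rightarrow> 'v \<Rightarrow> 't2" (infixl \<open>\<otimes>\<close> 72)
    and scale3 :: "'k \<Rightarrow> 't3::ab_group_add \<Rightarrow> 't3"
    and tens3 :: "'t2 \<Rightarrow> 'v \<Rightarrow> 't3" (infixl \<open>\<otimes>\<^sub>3\<close> 72)
begin

abbreviation lift2 :: "('v \<Rightarrow> 'v \<Rightarrow> 't2) \<Rightarrow> 't2 \<Rightarrow> 't2" where
  "lift2 \<equiv> tensor_lift scale2 tens scale2"

abbreviation lift3 :: "('v \<Rightarrow> 'v \<Rightarrow> 't3) \<Rightarrow> 't2 \<Rightarrow> 't3" where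
  "lift3 \<equiv> tensor_lift scale2 tens scale3"

abbreviation lift3_poly :: "('v \<Rightarrow> 'v \<Rightarrow> 't3 poly) \<Rightarrow> 't2 \<Rightarrow> 't3 poly" where
  "lift3_poly \<equiv> tensor_lift scale2 tens (\<lambda>c. map_poly (scale3 c))"

definition D2 :: "'t2 \<Rightarrow> 't2" where
  "D2 = lift2 (\<lambda>x y. D x \<otimes> y + x \<otimes> D y)"

definition swap :: "'t2 \<Rightarrow> 't2" where
  "swap = lift2 (\<lambda>x y. y \<otimes> x)"

definition outer :: "'v \<Rightarrow> 't2 \<Rightarrow> 'v \<Rightarrow> 't2" where
  \<comment> \<open>\<open>b d c\<close>\<close>
  "outer b d c = lift2 (\<lambda>x y. (b * x) \<otimes> (y * c)) d"

definition inner :: "'v \<Rightarrow> 't2 \<Rightarrow> 'v \<Rightarrow> 't2" where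
  \<comment> \<open>\<open>b *\<^sub>1 d *\<^sub>1 c\<close>\<close>
  "inner b d c = lift2 (\<lambda>x y. (x * c) \<otimes> (b * y)) d"

definition insert1 :: "'t2 \<Rightarrow> 'v \<Rightarrow> 't3" where
  \<comment> \<open>\<open>d \<otimes>\<^sub>1 c\<close>\<close>
  "insert1 d c = lift3 (\<lambda>x y. x \<otimes> c \<otimes>\<^sub>3 y) d"

definition tens_left :: "'v \<Rightarrow> 't2 \<Rightarrow> 't3" where
  \<comment> \<open>\<open>b \<otimes> d\<close> under the identification \<open>V \<otimes> (V \<otimes> V) = (V \<otimes> V) \<otimes> V\<close>\<close>
  "tens_left b d = lift3 (\<lambda>x y. b \<otimes> x \<otimes>\<^sub>3 y) d"


subsection \<open>Double lambda-brackets\<close>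

text \<open>In \<open>'t2 poly\<close> the variable is \<open>\<lambda>\<close>; multiplication by \<open>\<lambda>\<close> is \<open>pCons 0\<close>.\<close>

definition plus_lambda_D :: "'t2 poly \<Rightarrow> 't2 poly" where
  "plus_lambda_D p = pCons 0 p + map_poly D2 p"

definition bracket_L :: "('t2 \<Rightarrow> 't2 poly) \<Rightarrow> 'v \<Rightarrow> 't2 \<Rightarrow> 't3 poly" where
  "bracket_L B a d = lift3_poly (\<lambda>b' b''. map_poly (\<lambda>e. e \<otimes>\<^sub>3 b'') (B (a \<otimes> b'))) d"

definition bracket_R :: "('t2 \<Rightarrow> 't2 poly) \<Rightarrow> 'v \<Rightarrow> 't2 \<Rightarrow> 't3 poly" where
  "bracket_R B a d = lift3_poly (\<lambda>b' b''. map_poly (tens_left b') (B (a \<otimes> b''))) d"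

definition bracket_LL :: "('t2 \<Rightarrow> 't2 poly) \<Rightarrow> 't2 \<Rightarrow> 'v \<Rightarrow> 't3 poly" where
  "bracket_LL B d b = lift3_poly (\<lambda>a' a''.
     (\<Sum>n\<le>degree (B (a' \<otimes> b)). \<Sum>k\<le>n.
        monom (scale3 (of_nat (n choose k))
                 (insert1 (coeff (B (a' \<otimes> b)) n) ((D ^^ k) a''))) (n - k))) d"

text \<open>
  Polynomials in \<open>\<lambda>\<close> and \<open>\<mu>\<close> over \<open>V \<otimes> V \<otimes> V\<close> have type \<open>'t3 poly poly\<close>, with \<open>\<lambda>\<close> the inner and
  \<open>\<mu>\<close> the outer variable. The variables act as the operators \<open>mult_lambda\<close> and \<open>mult_mu\<close>,
  and \<open>subst_op X p\<close> is the polynomial \<open>p\<close> with its variable replaced by the operator \<open>X\<close>.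
\<close>

definition mult_lambda :: "'t3 poly poly \<Rightarrow> 't3 poly poly" where
  "mult_lambda = map_poly (pCons 0)"

definition mult_mu :: "'t3 poly poly \<Rightarrow> 't3 poly poly" where
  "mult_mu = pCons 0"

definition subst_op :: "('t3 poly poly \<Rightarrow> 't3 poly poly) \<Rightarrow> 't3 poly \<Rightarrow> 't3 poly poly" where
  "subst_op X p = (\<Sum>n\<le>degree p. (X ^^ n) [:[:coeff p n:]:])"

definition double_jacobi :: "('t2 \<Rightarrow> 't2 poly) \<Rightarrow> 'v \<Rightarrow> 'v \<Rightarrow> 'v \<Rightarrow> bool" where
  "double_jacobi B a b c \<longleftrightarrow>
     (\<Sum>n\<le>degree (B (b \<otimes> c)).
        (mult_mu ^^ n) (subst_op mult_lambda (bracket_L B a (coeff (B (b \<otimes> c)) n))))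
   - (\<Sum>n\<le>degree (B (a \<otimes> c)).
        (mult_lambda ^^ n) (subst_op mult_mu (bracket_R B b (coeff (B (a \<otimes> c)) n))))
   - (\<Sum>n\<le>degree (B (a \<otimes> b)).
        (mult_lambda ^^ n)
          (subst_op (\<lambda>X. mult_lambda X + mult_mu X) (bracket_LL B (coeff (B (a \<otimes> b)) n) c)))
   = 0"

definition double_lambda_bracket :: "('t2 \<Rightarrow> 't2 poly) \<Rightarrow> bool" where
  "double_lambda_bracket B \<longleftrightarrow>
     Vector_Spaces.linear scale2 (\<lambda>c. map_poly (scale2 c)) B
   \<and> (\<forall>a b. B (D a \<otimes> b) = - pCons 0 (B (a \<otimes> b)))
   \<and> (\<forall>a b. B (a \<otimes> D b) = plus_lambda_D (B (a \<otimes> b)))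
   \<and> (\<forall>a b c. B (a \<otimes> (b * c)) =
        map_poly (\<lambda>d. outer 1 d c) (B (a \<otimes> b)) + map_poly (\<lambda>d. outer b d 1) (B (a \<otimes> c)))
   \<and> (\<forall>a b c. B ((a * b) \<otimes> c) =
        (\<Sum>n\<le>max (degree (B (a \<otimes> c))) (degree (B (b \<otimes> c))). \<Sum>k\<le>n.
           monom (scale2 (of_nat (n choose k))
                    (inner 1 (coeff (B (a \<otimes> c)) n) ((D ^^ k) b)
                   + inner ((D ^^ k) a) (coeff (B (b \<otimes> c)) n) 1)) (n - k)))
   \<and> (\<forall>a b. B (a \<otimes> b) =
        - (\<Sum>n\<le>degree (B (b \<otimes> a)).
             ((\<lambda>p. - plus_lambda_D p) ^^ n) [:swap (coeff (B (b \<otimes> a)) n):]))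
   \<and> (\<forall>a b c. double_jacobi B a b c)"


subsection \<open>Double products\<close>

text \<open>
  \<open>P n a b\<close> is the \<open>n\<close>-th product of \<open>a\<close> and \<open>b\<close>. \<open>Sum_any\<close> sums over the support, which is
  finite below as only finitely many products of two given elements are nonzero.
\<close>

definition product_L :: "(nat \<Rightarrow> 'v \<Rightarrow> 'v \<Rightarrow> 't2) \<Rightarrow> nat \<Rightarrow> 'v \<Rightarrow> 't2 \<Rightarrow> 't3" where
  "product_L P n a d = lift3 (\<lambda>b' b''. P n a b' \<otimes>\<^sub>3 b'') d"

definition product_R :: "(nat \<Rightarrow> 'v \<Rightarrow> 'v \<Rightarrow> 't2) \<Rightarrow> nat \<Rightarrow> 'v \<Rightarrow> 't2 \<Rightarrow> 't3" where
  "product_R P n a d = lift3 (\<lambda>b' b''. tens_left b' (P n a b'')) d"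

definition product_LL :: "(nat \<Rightarrow> 'v \<Rightarrow> 'v \<Rightarrow> 't2) \<Rightarrow> nat \<Rightarrow> 't2 \<Rightarrow> 'v \<Rightarrow> 't3" where
  "product_LL P n d b = lift3 (\<lambda>a' a''.
     Sum_any (\<lambda>j. scale3 (1 / fact j) (insert1 (P (n + j) a' b) ((D ^^ j) a'')))) d"

definition double_products :: "(nat \<Rightarrow> 'v \<Rightarrow> 'v \<Rightarrow> 't2) \<Rightarrow> bool" where
  "double_products P \<longleftrightarrow>
     (\<forall>n. bilinear_map scale scale scale2 (P n))
   \<and> (\<forall>a b. \<exists>N. \<forall>n\<ge>N. P n a b = 0)
   \<and> (\<forall>n a b. P n (D a) b = - scale2 (of_nat n) (P (n - 1) a b))
   \<and> (\<forall>n a b. P n a (D b) = D2 (P n a b) + scale2 (of_nat n) (P (n - 1) a b))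
   \<and> (\<forall>n a b. P n a b =
        Sum_any (\<lambda>i. scale2 ((-1) ^ (n + i + 1) / fact i) ((D2 ^^ i) (swap (P (n + i) b a)))))
   \<and> (\<forall>m n a b c.
        product_L P m a (P n b c) - product_R P n b (P m a c)
        = (\<Sum>i\<le>m. scale3 (of_nat (m choose i)) (product_LL P (m + n - i) (P i a b) c)))
   \<and> (\<forall>n a b c. P n a (b * c) = outer 1 (P n a b) c + outer b (P n a c) 1)
   \<and> (\<forall>n a b c. P n (a * b) c =
        Sum_any (\<lambda>i. scale2 (1 / fact i) (inner ((D ^^ i) a) (P (n + i) b c) 1))
      + Sum_any (\<lambda>i. scale2 (1 / fact i) (inner 1 (P (n + i) a c) ((D ^^ i) b))))"


subsection \<open>Passing between the two\<close>

definition products_of_bracket :: "('t2 \<Rightarrow> 't2 poly) \<Rightarrow> nat \<Rightarrow> 'v \<Rightarrow> 'v \<Rightarrow> 't2" where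
  "products_of_bracket B n a b = scale2 (fact n) (coeff (B (a \<otimes> b)) n)"

definition generating_poly :: "(nat \<Rightarrow> 'v \<Rightarrow> 'v \<Rightarrow> 't2) \<Rightarrow> 'v \<Rightarrow> 'v \<Rightarrow> 't2 poly" where
  "generating_poly P a b = Sum_any (\<lambda>n. monom (scale2 (1 / fact n) (P n a b)) n)"

definition bracket_of_products :: "(nat \<Rightarrow> 'v \<Rightarrow> 'v \<Rightarrow> 't2) \<Rightarrow> 't2 \<Rightarrow> 't2 poly" where
  "bracket_of_products P =
     tensor_lift scale2 tens (\<lambda>c. map_poly (scale2 c)) (generating_poly P)"

end

end

theory Submission
  imports Defs
begin

text \<open>
  A linear map \<open>B\<close> on \<open>V \<otimes> V\<close> is determined by the coefficients of \<open>B (a \<otimes> b)\<close>, so only the axioms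
  have to be matched. Multiplying the \<open>\<lambda>\<^sup>m\<close>-coefficient (for the Jacobi identity, the
  \<open>\<lambda>\<^sup>m \<mu>\<^sup>n\<close>-coefficient) of each bracket axiom by \<open>m!\<close> (by \<open>m! n!\<close>) gives the corresponding product
  axiom: the binomial coefficients from expanding powers of \<open>\<lambda> + \<partial>\<close> are absorbed through
  \<open>m! \<cdot> ((m + k) choose k) = (m + k)! / k!\<close>, and those from powers of \<open>\<lambda> + \<mu>\<close> through
  \<open>m! n! \<cdot> ((m - i + n) choose n) = (m choose i) \<cdot> i! \<cdot> (m + n - i)!\<close>.
\<close>

section \<open>Linear and bilinear maps, also under finite sums\<close>

lemmas linear_addD = module_hom.add[OF module_hom_linearI]
  and linear_scaleD = module_hom.scale[OF module_hom_linearI]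
  and linear_zeroD = module_hom.zero[OF module_hom_linearI]
  and linear_sumD = module_hom.sum[OF module_hom_linearI]

lemma linear_comp:
  "Vector_Spaces.linear s1 s2 f \<Longrightarrow> Vector_Spaces.linear s2 s3 g
    \<Longrightarrow> Vector_Spaces.linear s1 s3 (\<lambda>x. g (f x))"
  by (simp add: Vector_Spaces.linear_iff)

lemma linear_plus:
  assumes "Vector_Spaces.linear s1 s2 f" "Vector_Spaces.linear s1 s2 g"
  shows "Vector_Spaces.linear s1 s2 (\<lambda>x. f x + g x)"
proof -
  interpret vector_space s2 using assms by (simp add: Vector_Spaces.linear_iff)
  show ?thesis using assms by (simp add: Vector_Spaces.linear_iff algebra_simps)
qed

lemma linear_scaled:
  assumes "Vector_Spaces.linear s1 s2 f"
  shows "Vector_Spaces.linear s1 s2 (\<lambda>x. s2 c (f x))"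
proof -
  interpret vector_space s2 using assms by (simp add: Vector_Spaces.linear_iff)
  show ?thesis using assms by (simp add: Vector_Spaces.linear_iff algebra_simps)
qed

text \<open>\<open>h\<close> may kill terms, so both sums are taken over the support of
  \<open>f\<close>, which contains that of the image. Finiteness matters because
  \<open>Sum_any\<close> is 0 on an infinite support, while the image could still have a finite
  one.\<close>

lemma linear_Sum_any:
  assumes "Vector_Spaces.linear s1 s2 h" "finite {k. f k \<noteq> 0}"
  shows "h (Sum_any f) = Sum_any (\<lambda>k. h (f k))"
proof -
  have "Sum_any (\<lambda>k. h (f k)) = (\<Sum>k\<in>{k. f k \<noteq> 0}. h (f k))"
    using assms(2) by (rule Sum_any.expand_superset) (use linear_zeroD[OF assms(1)] in auto)
  then show ?thesis
    by (simp add: Sum_any.expand_set linear_sumD[OF assms(1)])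
qed

lemma linear_funpow:
  assumes "Vector_Spaces.linear s s f"
  shows "Vector_Spaces.linear s s (f ^^ n)"
proof (induction n)
  case 0
  then show ?case using assms by (simp add: Vector_Spaces.linear_iff)
next
  case (Suc n)
  then show ?case using assms by (simp add: Vector_Spaces.linear_iff)
qed

lemma bilinear_mapI:
  assumes "vector_space sA" "vector_space sB" "vector_space sW"
    and "\<And>a a' b. f (a + a') b = f a b + f a' b" "\<And>c a b. f (sA c a) b = sW c (f a b)"
    and "\<And>a b b'. f a (b + b') = f a b + f a b'" "\<And>c a b. f a (sB c b) = sW c (f a b)"
  shows "bilinear_map sA sB sW f"
  using assms by (simp add: bilinear_map_def Vector_Spaces.linear_iff)

lemma bilinear_mapD:
  assumes "bilinear_map sA sB sW f"
  shows "f (a + a') b = f a b + f a' b" "f (sA c a) b = sW c (f a b)"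
    "f a (b + b') = f a b + f a b'" "f a (sB c b) = sW c (f a b)"
    "f 0 b = 0" "f a 0 = 0"
proof -
  have l: "Vector_Spaces.linear sA sW (\<lambda>a. f a b)" for b
    using assms by (simp add: bilinear_map_def)
  have r: "Vector_Spaces.linear sB sW (f a)" for a
    using assms by (simp add: bilinear_map_def)
  show "f (a + a') b = f a b + f a' b" "f (sA c a) b = sW c (f a b)" "f 0 b = 0"
    by (fact linear_addD[OF l] linear_scaleD[OF l] linear_zeroD[OF l])+
  show "f a (b + b') = f a b + f a b'" "f a (sB c b) = sW c (f a b)" "f a 0 = 0"
    by (fact linear_addD[OF r] linear_scaleD[OF r] linear_zeroD[OF r])+
qed

lemma bilinear_map_linear_comp:
  assumes "bilinear_map sA sB sW f" "Vector_Spaces.linear sW sX h"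
  shows "bilinear_map sA sB sX (\<lambda>a b. h (f a b))"
  using assms by (simp add: bilinear_map_def Vector_Spaces.linear_iff)

lemma bilinear_map_Sum_any:
  assumes "vector_space sA" "vector_space sB" "vector_space sW"
    and bil: "\<And>k. bilinear_map sA sB sW (f k)" and fin: "\<And>a b. finite {k. f k a b \<noteq> 0}"
  shows "bilinear_map sA sB sW (\<lambda>a b. Sum_any (\<lambda>k. f k a b))"
proof -
  interpret vector_space sW by fact
  have scale: "Vector_Spaces.linear sW sW (sW c)" for c
    by (simp add: Vector_Spaces.linear_iff assms algebra_simps)
  show ?thesis
    by (intro bilinear_mapI assms)
      (simp_all add: bilinear_mapD[OF bil] Sum_any.distrib fin linear_Sum_any[OF scale])
qed

section \<open>Polynomials with coefficients in a vector space\<close>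

lemma vector_space_poly:
  assumes "vector_space s"
  shows "vector_space (\<lambda>c. map_poly (s c))"
proof -
  interpret vector_space s by fact
  show ?thesis
    by unfold_locales (auto simp: poly_eq_iff coeff_map_poly algebra_simps)
qed

lemma linear_coeff:
  assumes "vector_space s"
  shows "Vector_Spaces.linear (\<lambda>c. map_poly (s c)) s (\<lambda>p. coeff p n)"
proof -
  interpret vector_space s by fact
  show ?thesis
    using vector_space_poly[OF assms] assms
    by (simp add: Vector_Spaces.linear_iff coeff_map_poly)
qed

text \<open>Addition and scaling of polynomials are coefficientwise. This serves for polynomials
  written as sums whose upper bound is a degree, hence varies with the arguments, so that linearity
  is only visible on coefficients.\<close>

lemma bilinear_map_poly:
  assumes "vector_space sA" "vector_space sB" "vector_space sW"
    and "\<And>n. bilinear_map sA sB sW (\<lambda>a b. coeff (f a b) n)"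
  shows "bilinear_map sA sB (\<lambda>c. map_poly (sW c)) f"
proof -
  interpret vector_space sW by fact
  show ?thesis
    using assms(1-3) vector_space_poly[OF assms(3)]
    by (intro bilinear_mapI) (auto simp: poly_eq_iff coeff_map_poly bilinear_mapD[OF assms(4)])
qed

section \<open>Linear maps out of a tensor product\<close>

context tensor_product
begin

text \<open>\<open>f\<close> is the composite of \<open>g\<close> with \<open>tens\<close>, hence
  bilinear, and the uniqueness half of the universal property applies.\<close>

lemma tensor_lift_unique:
  assumes "Vector_Spaces.linear sT sW g" "\<And>a b. g (tens a b) = f a b"
  shows "tensor_lift sT tens sW f = g"
proof -
  have W: "vector_space sW" using assms(1) by (simp add: Vector_Spaces.linear_iff)
  have "f = (\<lambda>a b. g (tens a b))" using assms(2) by auto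
  then have "bilinear_map sA sB sW f"
    using bilinear_map_linear_comp[OF bilinear_tens assms(1)] by simp
  from universal_property[OF W this] show ?thesis
    unfolding tensor_lift_def using assms by (intro the1_equality) auto
qed

text \<open>Both sides are linear in \<open>t\<close> and agree on pure tensors. With
  \<open>h\<close> a scaled coefficient map this carries polynomial-valued lifts to lifts of
  coefficients.\<close>

lemma linear_comp_tensor_lift:
  assumes "bilinear_map sA sB sW f" "Vector_Spaces.linear sW sX h"
  shows "h (tensor_lift sT tens sW f t) = tensor_lift sT tens sX (\<lambda>a b. h (f a b)) t"
proof -
  have W: "vector_space sW" using assms(2) by (simp add: Vector_Spaces.linear_iff)
  have "tensor_lift sT tens sX (\<lambda>a b. h (f a b)) = (\<lambda>t. h (tensor_lift sT tens sW f t))"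
    by (intro tensor_lift_unique linear_comp[OF linear_tensor_lift[OF W assms(1)] assms(2)])
      (simp add: tensor_lift_tens[OF W assms(1)])
  then show ?thesis by simp
qed

text \<open>By uniqueness, a sum or multiple of lifts is the lift of the sum or multiple, so a lift
  inherits linear dependence on a parameter \<open>c\<close>. The parameter is the vector inserted
  by \<open>insert1\<close> or \<open>tens_left\<close>.\<close>

lemma bilinear_map_tensor_lift:
  assumes "vector_space sC" "vector_space sW"
    and "\<And>c. bilinear_map sA sB sW (f c)"
    and "\<And>a b. Vector_Spaces.linear sC sW (\<lambda>c. f c a b)"
  shows "bilinear_map sC sT sW (\<lambda>c. tensor_lift sT tens sW (f c))"
proof -
  note lin = linear_tensor_lift[OF assms(2,3)] and eq = tensor_lift_tens[OF assms(2,3)]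
  have "tensor_lift sT tens sW (f (c + c'))
      = (\<lambda>t. tensor_lift sT tens sW (f c) t + tensor_lift sT tens sW (f c') t)" for c c'
    by (intro tensor_lift_unique linear_plus lin) (simp add: eq linear_addD[OF assms(4)])
  moreover have "tensor_lift sT tens sW (f (sC r c))
      = (\<lambda>t. sW r (tensor_lift sT tens sW (f c) t))" for r c
    by (intro tensor_lift_unique linear_scaled lin) (simp add: eq linear_scaleD[OF assms(4)])
  ultimately show ?thesis
    by (intro bilinear_mapI)
      (simp_all add: assms T.vector_space_axioms linear_addD[OF lin] linear_scaleD[OF lin])
qed

end

section \<open>From degree-bounded sums to sums over the support\<close>

lemma sum_atMost_shift:
  fixes h :: "nat \<Rightarrow> 'a::comm_monoid_add"
  assumes "\<And>n. n < m \<Longrightarrow> h n = 0" "\<And>n. N < n \<Longrightarrow> h n = 0"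
  shows "(\<Sum>n\<le>N. h n) = Sum_any (\<lambda>k. h (m + k))"
proof -
  have "(\<Sum>n\<le>N. h n) = (\<Sum>n\<in>{m..N}. h n)"
    by (intro sum.mono_neutral_right) (auto simp: assms(1))
  also have "\<dots> = (\<Sum>k\<in>{k. m + k \<le> N}. h (m + k))"
    by (rule sum.reindex_bij_witness[of _ "\<lambda>k. m + k" "\<lambda>n. n - m"]) auto
  also have "\<dots> = Sum_any (\<lambda>k. h (m + k))"
  proof (rule Sum_any.expand_superset[symmetric])
    show "finite {k. m + k \<le> N}" by (rule finite_subset[of _ "{..N}"]) auto
    show "{k. h (m + k) \<noteq> 0} \<subseteq> {k. m + k \<le> N}" using assms(2) not_le by blast
  qed
  finally show ?thesis .
qed

text \<open>For \<open>k \<le> n\<close> the exponent \<open>n - k\<close> equals \<open>m\<close>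
  only if \<open>n = m + k\<close>, so each \<open>k\<close> contributes one term. The bound
  \<open>N\<close> disappears because later terms vanish; this is how the bounded sums of the
  bracket axioms become the unbounded sums of the product axioms.\<close>

lemma coeff_sum_monom_diff:
  fixes g :: "nat \<Rightarrow> nat \<Rightarrow> 'a::ab_group_add"
  assumes "\<And>n k. N < n \<Longrightarrow> g n k = 0"
  shows "coeff (\<Sum>n\<le>N. \<Sum>k\<le>n. monom (g n k) (n - k)) m = Sum_any (\<lambda>k. g (m + k) k)"
proof -
  have "(\<Sum>k\<le>n. if n - k = m then g n k else 0) = (if m \<le> n then g n (n - m) else 0)" for n
  proof -
    have "(\<Sum>k\<le>n. if n - k = m then g n k else 0)
        = (\<Sum>k\<le>n. if m \<le> n \<and> k = n - m then g n k else 0)"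
      by (intro sum.cong) auto
    then show ?thesis by simp
  qed
  then have "coeff (\<Sum>n\<le>N. \<Sum>k\<le>n. monom (g n k) (n - k)) m
      = (\<Sum>n\<le>N. if m \<le> n then g n (n - m) else 0)"
    by (simp add: coeff_sum)
  also have "\<dots> = Sum_any (\<lambda>k. if m \<le> m + k then g (m + k) (m + k - m) else 0)"
    by (rule sum_atMost_shift) (auto simp: assms)
  finally show ?thesis by simp
qed

lemma fact_mult_binomial:
  "fact m * of_nat ((m + k) choose k) = (fact (m + k) / fact k :: 'k::field_char_0)"
  using binomial_fact[of k "m + k", where 'a = 'k] by simp

section \<open>Linearity of the operations on tensor powers\<close>

context differential_algebra_tensors
begin

abbreviation scale2_poly :: "'k \<Rightarrow> 't2 poly \<Rightarrow> 't2 poly" where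
  "scale2_poly \<equiv> \<lambda>c. map_poly (scale2 c)"

abbreviation scale3_poly :: "'k \<Rightarrow> 't3 poly \<Rightarrow> 't3 poly" where
  "scale3_poly \<equiv> \<lambda>c. map_poly (scale3 c)"

lemmas spaces = vector_space_axioms T2.T.vector_space_axioms T3.T.vector_space_axioms
  vector_space_poly[OF T2.T.vector_space_axioms] vector_space_poly[OF T3.T.vector_space_axioms]

lemmas tens_simps = bilinear_mapD[OF T2.bilinear_tens]
  and tens3_simps = bilinear_mapD[OF T3.bilinear_tens]

lemmas D_simps = linear_addD[OF linear_D] linear_scaleD[OF linear_D]

lemmas linear_coeff2 = linear_coeff[OF T2.T.vector_space_axioms]
  and linear_coeff3 = linear_coeff[OF T3.T.vector_space_axioms]

lemma bilinear_D2: "bilinear_map scale scale scale2 (\<lambda>x y. D x \<otimes> y + x \<otimes> D y)"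
  by (intro bilinear_mapI spaces) (simp_all add: tens_simps D_simps T2.T.scale_right_distrib)

lemma linear_D2: "Vector_Spaces.linear scale2 scale2 D2"
  unfolding D2_def by (intro T2.linear_tensor_lift spaces bilinear_D2)

lemma linear_swap: "Vector_Spaces.linear scale2 scale2 swap"
  unfolding swap_def
  by (intro T2.linear_tensor_lift bilinear_mapI spaces) (simp_all add: tens_simps)

lemma linear_outer: "Vector_Spaces.linear scale2 scale2 (\<lambda>d. outer b d c)"
  unfolding outer_def
  by (intro T2.linear_tensor_lift bilinear_mapI spaces)
    (simp_all add: tens_simps distrib_left distrib_right flip: scale_mult_left scale_mult_right)

lemma linear_inner: "Vector_Spaces.linear scale2 scale2 (\<lambda>d. inner b d c)"
  unfolding inner_def
  by (intro T2.linear_tensor_lift bilinear_mapI spaces)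
    (simp_all add: tens_simps distrib_left distrib_right flip: scale_mult_left scale_mult_right)

lemma bilinear_insert1: "bilinear_map scale2 scale scale3 insert1"
proof -
  \<comment> \<open>\<open>insert1\<close> lifts in its first argument, so bilinearity is first
    obtained with the arguments exchanged.\<close>
  have "bilinear_map scale scale2 scale3 (\<lambda>c. lift3 (\<lambda>x y. x \<otimes> c \<otimes>\<^sub>3 y))"
    by (intro T2.bilinear_map_tensor_lift bilinear_mapI spaces)
      (simp_all add: tens_simps tens3_simps Vector_Spaces.linear_iff spaces)
  then show ?thesis by (simp add: bilinear_map_def insert1_def [abs_def])
qed

lemma bilinear_tens_left: "bilinear_map scale scale2 scale3 tens_left"
  unfolding tens_left_def
    by (intro T2.bilinear_map_tensor_lift bilinear_mapI spaces)
      (simp_all add: tens_simps tens3_simps Vector_Spaces.linear_iff spaces)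

lemmas D2_simps = linear_addD[OF linear_D2] linear_scaleD[OF linear_D2] linear_zeroD[OF linear_D2]
  and swap_simps = linear_addD[OF linear_swap] linear_scaleD[OF linear_swap] linear_zeroD[OF linear_swap]
  and outer_simps = linear_addD[OF linear_outer] linear_scaleD[OF linear_outer] linear_zeroD[OF linear_outer]
  and inner_simps = linear_addD[OF linear_inner] linear_scaleD[OF linear_inner] linear_zeroD[OF linear_inner]
  and insert1_simps = bilinear_mapD[OF bilinear_insert1]
  and tens_left_simps = bilinear_mapD[OF bilinear_tens_left]

section \<open>Coefficients of powers of -\<lambda> - \<partial>, \<lambda>, \<mu> and \<lambda> +
  \<mu>\<close>

lemma coeff_plus_lambda_D:
  "coeff (plus_lambda_D p) m = (if m = 0 then 0 else coeff p (m - 1)) + D2 (coeff p m)"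
  by (simp add: plus_lambda_D_def coeff_map_poly D2_simps coeff_pCons')

text \<open>Binomial expansion of (-\<lambda> - \<partial>)^n on a constant, by Pascal's rule. For
  \<open>m > n\<close> the binomial coefficient is 0, so the truncated exponent \<open>n - m\<close>
  is harmless.\<close>

lemma coeff_minus_plus_lambda_D_power:
  "coeff (((\<lambda>p. - plus_lambda_D p) ^^ n) [:x:]) m
     = scale2 ((- 1) ^ n * of_nat (n choose m)) ((D2 ^^ (n - m)) x)"
proof (induction n arbitrary: m)
  case 0
  then show ?case by (cases m) auto
next
  case (Suc n)
  show ?case
  proof (cases m)
    case 0
    then show ?thesis by (simp add: Suc coeff_plus_lambda_D D2_simps)
  next
    case (Suc j)
    have "D2 (coeff (((\<lambda>p. - plus_lambda_D p) ^^ n) [:x:]) m)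
        = scale2 ((- 1) ^ n * of_nat (n choose Suc j)) ((D2 ^^ (n - j)) x)"
    \<comment> \<open>One more \<open>D2\<close> raises the exponent \<open>n - Suc j\<close> to
      \<open>n - j\<close> only if \<open>j < n\<close>; otherwise \<open>n choose Suc j\<close> is
      0 and both sides vanish.\<close>
    proof (cases "j < n")
      case True
      then have "n - j = Suc (n - Suc j)" by simp
      then show ?thesis by (simp add: Suc.IH Suc D2_simps)
    qed (simp add: Suc.IH Suc D2_simps)
    then show ?thesis
      by (simp add: Suc Suc.IH coeff_plus_lambda_D algebra_simps)
  qed
qed

lemma coeff_mult_lambda:
  "coeff (coeff (mult_lambda q) j) i = (if i = 0 then 0 else coeff (coeff q j) (i - 1))"
  by (simp add: mult_lambda_def coeff_map_poly coeff_pCons')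

lemma coeff_mult_mu:
  "coeff (coeff (mult_mu q) j) i = (if j = 0 then 0 else coeff (coeff q (j - 1)) i)"
  by (simp add: mult_mu_def coeff_pCons')

lemma coeff_mult_lambda_power:
  "coeff (coeff ((mult_lambda ^^ n) q) j) i = (if i < n then 0 else coeff (coeff q j) (i - n))"
  by (induction n arbitrary: i) (auto simp: coeff_mult_lambda)

lemma coeff_mult_mu_power:
  "coeff (coeff ((mult_mu ^^ n) q) j) i = (if j < n then 0 else coeff (coeff q (j - n)) i)"
  by (induction n arbitrary: j) (auto simp: coeff_mult_mu)

text \<open>Binomial theorem for (\<lambda> + \<mu>)^n: the monomial \<lambda>^i \<mu>^j arises from
  \<lambda>^(i-1) \<mu>^j and from \<lambda>^i \<mu>^(j-1), which is Pascal's rule.\<close>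

lemma coeff_mult_lambda_mu_power:
  "coeff (coeff (((\<lambda>X. mult_lambda X + mult_mu X) ^^ n) [:[:c:]:]) j) i
     = (if i + j = n then scale3 (of_nat (n choose j)) c else 0)"
proof (induction n arbitrary: i j)
  case 0
  then show ?case by (auto simp: coeff_pCons')
next
  case (Suc n)
  show ?case
    by (cases i; cases j)
      (auto simp: Suc coeff_mult_lambda coeff_mult_mu algebra_simps)
qed

text \<open>Only the summand \<open>n = i\<close> reaches \<lambda>^i; if \<open>i\<close> exceeds
  the degree, \<open>coeff p i\<close> is 0 as well.\<close>

lemma coeff_subst_lambda:
  "coeff (coeff (subst_op mult_lambda p) j) i = (if j = 0 then coeff p i else 0)"
proof -
  have "coeff (coeff (subst_op mult_lambda p) j) i
      = (\<Sum>n\<le>degree p. if n = i then (if j = 0 then coeff p n else 0) else 0)"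
    unfolding subst_op_def coeff_sum coeff_mult_lambda_power
    by (intro sum.cong) (auto simp: coeff_pCons')
  then show ?thesis by (simp add: coeff_eq_0)
qed

lemma coeff_subst_mu:
  "coeff (coeff (subst_op mult_mu p) j) i = (if i = 0 then coeff p j else 0)"
proof -
  have "coeff (coeff (subst_op mult_mu p) j) i
      = (\<Sum>n\<le>degree p. if n = j then (if i = 0 then coeff p n else 0) else 0)"
    unfolding subst_op_def coeff_sum coeff_mult_mu_power
    by (intro sum.cong) (auto simp: coeff_pCons')
  then show ?thesis by (simp add: coeff_eq_0)
qed

lemma coeff_subst_lambda_mu:
  "coeff (coeff (subst_op (\<lambda>X. mult_lambda X + mult_mu X) p) j) i
     = scale3 (of_nat ((i + j) choose j)) (coeff p (i + j))"
proof -
  have "coeff (coeff (subst_op (\<lambda>X. mult_lambda X + mult_mu X) p) j) i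
      = (\<Sum>n\<le>degree p. if n = i + j then scale3 (of_nat ((i + j) choose j)) (coeff p n) else 0)"
    unfolding subst_op_def coeff_sum coeff_mult_lambda_mu_power
    by (intro sum.cong) auto
  then show ?thesis by (simp add: coeff_eq_0)
qed

lemma linear_scale2: "Vector_Spaces.linear scale2 scale2 (scale2 c)"
  by (simp add: Vector_Spaces.linear_iff spaces T2.T.scale_right_distrib)

lemma linear_scale3: "Vector_Spaces.linear scale3 scale3 (scale3 c)"
  by (simp add: Vector_Spaces.linear_iff spaces T3.T.scale_right_distrib)

text \<open>Factorials are nonzero in characteristic 0. The scaled coefficients of a bracket are
  precisely its products.\<close>

lemma poly_eq_iff_scaled:
  "p = q \<longleftrightarrow> (\<forall>n. scale2 (fact n) (coeff p n) = scale2 (fact n) (coeff q n))"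
  by (simp add: poly_eq_iff)

lemma poly_poly_eq_iff_scaled:
  "p = q \<longleftrightarrow> (\<forall>j i. scale3 (fact i * fact j) (coeff (coeff p j) i)
                 = scale3 (fact i * fact j) (coeff (coeff q j) i))"
  by (simp add: poly_eq_iff)

section \<open>Sesquilinearity, Leibniz rules and skewsymmetry for a linear map
  \<open>B\<close>\<close>

context
  fixes B :: "'t2 \<Rightarrow> 't2 poly"
  assumes linear_B: "Vector_Spaces.linear scale2 (\<lambda>c. map_poly (scale2 c)) B"
begin

private abbreviation P :: "nat \<Rightarrow> 'v \<Rightarrow> 'v \<Rightarrow> 't2" where
  "P \<equiv> products_of_bracket B"

lemma bilinear_coeff: "bilinear_map scale scale scale2 (\<lambda>a b. coeff (B (a \<otimes> b)) n)"
  by (rule bilinear_map_linear_comp[OF bilinear_map_linear_comp[OF T2.bilinear_tens linear_B]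
        linear_coeff2])

lemmas coeff_B_simps = bilinear_mapD[OF bilinear_coeff]

lemma bilinear_products: "bilinear_map scale scale scale2 (P n)"
  using bilinear_map_linear_comp[OF bilinear_coeff linear_scale2]
  by (simp add: products_of_bracket_def [abs_def])

lemma products_eventually_zero: "\<exists>N. \<forall>n\<ge>N. P n a b = 0"
  by (rule exI[of _ "Suc (degree (B (a \<otimes> b)))"])
    (simp add: products_of_bracket_def coeff_eq_0)

text \<open>Products vanish beyond the degree of the bracket. This provides the finite supports that
  keep the \<open>Sum_any\<close> terms below from defaulting to 0.\<close>

lemma finite_products: "finite {i. P (m + i) a b \<noteq> 0}"
  by (rule finite_subset[of _ "{..degree (B (a \<otimes> b))}"])
    (auto simp: products_of_bracket_def intro: ccontr dest!: le_degree)

lemma sesquilinear_left_iff: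
  "(\<forall>a b. B (D a \<otimes> b) = - pCons 0 (B (a \<otimes> b)))
    \<longleftrightarrow> (\<forall>n a b. P n (D a) b = - scale2 (of_nat n) (P (n - 1) a b))"
proof -
  \<comment> \<open>For positive \<open>n\<close> this is n! = n (n-1)!. For \<open>n = 0\<close>
    the truncated \<open>n - 1\<close> is multiplied by 0, matching the zero constant term of
    \<open>pCons 0\<close>.\<close>
  have "scale2 (fact n) (coeff (- pCons 0 (B (a \<otimes> b))) n)
      = - scale2 (of_nat n) (P (n - 1) a b)" for n a b
    by (cases n) (simp_all add: products_of_bracket_def)
  then show ?thesis
    unfolding poly_eq_iff_scaled by (auto simp: products_of_bracket_def)
qed

lemma sesquilinear_right_iff:
  "(\<forall>a b. B (a \<otimes> D b) = plus_lambda_D (B (a \<otimes> b)))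
    \<longleftrightarrow> (\<forall>n a b. P n a (D b) = D2 (P n a b) + scale2 (of_nat n) (P (n - 1) a b))"
proof -
  have "scale2 (fact n) (coeff (plus_lambda_D (B (a \<otimes> b))) n)
      = D2 (P n a b) + scale2 (of_nat n) (P (n - 1) a b)" for n a b
    by (cases n)
      (simp_all add: products_of_bracket_def coeff_plus_lambda_D D2_simps T2.T.scale_right_distrib)
  then show ?thesis
    unfolding poly_eq_iff_scaled by (auto simp: products_of_bracket_def)
qed

lemma leibniz_right_iff:
  "(\<forall>a b c. B (a \<otimes> (b * c)) =
      map_poly (\<lambda>d. outer 1 d c) (B (a \<otimes> b)) + map_poly (\<lambda>d. outer b d 1) (B (a \<otimes> c)))
    \<longleftrightarrow> (\<forall>n a b c. P n a (b * c) = outer 1 (P n a b) c + outer b (P n a c) 1)"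
  unfolding poly_eq_iff_scaled
  by (auto simp: products_of_bracket_def coeff_map_poly outer_simps T2.T.scale_right_distrib)

lemma leibniz_left_iff:
  "(\<forall>a b c. B ((a * b) \<otimes> c) =
      (\<Sum>n\<le>max (degree (B (a \<otimes> c))) (degree (B (b \<otimes> c))). \<Sum>k\<le>n.
         monom (scale2 (of_nat (n choose k))
                  (inner 1 (coeff (B (a \<otimes> c)) n) ((D ^^ k) b)
                 + inner ((D ^^ k) a) (coeff (B (b \<otimes> c)) n) 1)) (n - k)))
    \<longleftrightarrow> (\<forall>n a b c. P n (a * b) c =
          Sum_any (\<lambda>i. scale2 (1 / fact i) (inner ((D ^^ i) a) (P (n + i) b c) 1))
        + Sum_any (\<lambda>i. scale2 (1 / fact i) (inner 1 (P (n + i) a c) ((D ^^ i) b))))"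
proof -
  have "scale2 (fact m) (coeff
      (\<Sum>n\<le>max (degree (B (a \<otimes> c))) (degree (B (b \<otimes> c))). \<Sum>k\<le>n.
         monom (scale2 (of_nat (n choose k))
                  (inner 1 (coeff (B (a \<otimes> c)) n) ((D ^^ k) b)
                 + inner ((D ^^ k) a) (coeff (B (b \<otimes> c)) n) 1)) (n - k)) m)
     = Sum_any (\<lambda>i. scale2 (1 / fact i) (inner ((D ^^ i) a) (P (m + i) b c) 1))
        + Sum_any (\<lambda>i. scale2 (1 / fact i) (inner 1 (P (m + i) a c) ((D ^^ i) b)))"
    (is "scale2 _ ?c = Sum_any ?g + Sum_any ?h") for m a b c
  proof -
    \<comment> \<open>The contribution to \<lambda>^m of the summand with \<open>n = m + k\<close>.
      Scaled by m! it splits into one term of each product sum.\<close>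
    let ?f = "\<lambda>k. scale2 (of_nat (m + k choose k))
                (inner 1 (coeff (B (a \<otimes> c)) (m + k)) ((D ^^ k) b)
               + inner ((D ^^ k) a) (coeff (B (b \<otimes> c)) (m + k)) 1)"
    have g: "finite {i. ?g i \<noteq> 0}"
      by (rule finite_subset[OF _ finite_products[of m b c]]) (auto simp: inner_simps)
    have h: "finite {i. ?h i \<noteq> 0}"
      by (rule finite_subset[OF _ finite_products[of m a c]]) (auto simp: inner_simps)
    have f: "scale2 (fact m) (?f k) = ?g k + ?h k" for k
      by (simp add: T2.T.scale_right_distrib fact_mult_binomial products_of_bracket_def inner_simps)
    \<comment> \<open>Scaling by the nonzero m! keeps the support, so a nonzero \<open>?f k\<close>
      forces \<open>?g k\<close> or \<open>?h k\<close> to be nonzero.\<close>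
    have "{k. ?f k \<noteq> 0} \<subseteq> {i. ?g i \<noteq> 0} \<union> {i. ?h i \<noteq> 0}"
    proof
      fix k assume "k \<in> {k. ?f k \<noteq> 0}"
      then have "scale2 (fact m) (?f k) \<noteq> 0" by simp
      then show "k \<in> {i. ?g i \<noteq> 0} \<union> {i. ?h i \<noteq> 0}" unfolding f by auto
    qed
    then have fin: "finite {k. ?f k \<noteq> 0}" using g h finite_subset by blast
    \<comment> \<open>Beyond the larger of the two degrees both coefficients vanish, so the
      \<open>max\<close> bound loses no term.\<close>
    have "?c = Sum_any ?f"
      by (rule coeff_sum_monom_diff) (simp add: coeff_eq_0 inner_simps)
    then have "scale2 (fact m) ?c = Sum_any (\<lambda>k. scale2 (fact m) (?f k))"
      by (simp only: linear_Sum_any[OF linear_scale2 fin])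
    also have "\<dots> = Sum_any ?g + Sum_any ?h"
      unfolding f by (rule Sum_any.distrib[OF g h])
    finally show ?thesis .
  qed
  then show ?thesis
    unfolding poly_eq_iff_scaled by (auto simp: products_of_bracket_def)
qed

lemma skewsymmetry_iff:
  "(\<forall>a b. B (a \<otimes> b) =
      - (\<Sum>n\<le>degree (B (b \<otimes> a)).
           ((\<lambda>p. - plus_lambda_D p) ^^ n) [:swap (coeff (B (b \<otimes> a)) n):]))
    \<longleftrightarrow> (\<forall>n a b. P n a b =
        Sum_any (\<lambda>i. scale2 ((-1) ^ (n + i + 1) / fact i) ((D2 ^^ i) (swap (P (n + i) b a)))))"
proof -
  note D2_power = linear_scaleD[OF linear_funpow[OF linear_D2]]
    linear_zeroD[OF linear_funpow[OF linear_D2]]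
  have "scale2 (fact m) (coeff (- (\<Sum>n\<le>degree (B (b \<otimes> a)).
           ((\<lambda>p. - plus_lambda_D p) ^^ n) [:swap (coeff (B (b \<otimes> a)) n):])) m)
     = Sum_any (\<lambda>i. scale2 ((-1) ^ (m + i + 1) / fact i) ((D2 ^^ i) (swap (P (m + i) b a))))"
    (is "scale2 _ ?c = Sum_any ?g") for m a b
  proof -
    \<comment> \<open>The \<lambda>^m coefficient of the \<open>n\<close>-th summand, zero for
      \<open>n < m\<close>. At \<open>n = m + i\<close> its sign is that of
      \<open>(-1) ^ (m + i + 1)\<close>, the extra minus being the one in front of the sum.\<close>
    let ?f = "\<lambda>n. scale2 (- ((- 1) ^ n) * of_nat (n choose m))
      ((D2 ^^ (n - m)) (swap (coeff (B (b \<otimes> a)) n)))"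
    have f: "scale2 (fact m) (?f (m + i)) = ?g i" for i
    proof -
      have "fact m * of_nat (m + i choose m) = (fact (m + i) / fact i :: 'k)"
        using fact_mult_binomial[of m i] binomial_symmetric[of m "m + i"] by simp
      then have "fact m * ((- 1) ^ (m + i) * of_nat (m + i choose m))
          = (- 1) ^ (m + i) * (fact (m + i) / fact i :: 'k)"
        by (metis mult.left_commute)
      then show ?thesis
        by (simp add: products_of_bracket_def swap_simps D2_power)
    qed
    have "finite {i. ?g i \<noteq> 0}"
      by (rule finite_subset[OF _ finite_products[of m b a]]) (auto simp: swap_simps D2_power)
    moreover have "?f (m + i) \<noteq> 0 \<longleftrightarrow> ?g i \<noteq> 0" for i
      unfolding f[symmetric] by simp
    ultimately have fin: "finite {i. ?f (m + i) \<noteq> 0}" by simp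
    have "?c = (\<Sum>n\<le>degree (B (b \<otimes> a)). ?f n)"
      by (simp add: coeff_sum coeff_minus_plus_lambda_D_power sum_negf)
    also have "\<dots> = Sum_any (\<lambda>i. ?f (m + i))"
      by (rule sum_atMost_shift) (auto simp: coeff_eq_0 swap_simps D2_power)
    finally show ?thesis
      by (simp only: linear_Sum_any[OF linear_scale2 fin] f)
  qed
  note scaled = this
  show ?thesis
    unfolding poly_eq_iff_scaled scaled products_of_bracket_def[symmetric] by blast
qed

section \<open>The Jacobi identity\<close>

lemma bilinear_bracket_L:
  "bilinear_map scale scale scale3_poly (\<lambda>b' b''. map_poly (\<lambda>e. e \<otimes>\<^sub>3 b'') (B (a \<otimes> b')))"
  by (intro bilinear_map_poly bilinear_mapI spaces)
    (simp_all add: coeff_map_poly tens3_simps coeff_B_simps)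

lemma bilinear_bracket_R:
  "bilinear_map scale scale scale3_poly (\<lambda>b' b''. map_poly (tens_left b') (B (a \<otimes> b'')))"
  by (intro bilinear_map_poly bilinear_mapI spaces)
    (simp_all add: coeff_map_poly tens_left_simps coeff_B_simps)

lemma finite_insert1_coeff:
  "finite {k. scale3 (c k) (insert1 (coeff (B (a' \<otimes> b)) (n + k)) ((D ^^ k) a'')) \<noteq> 0}"
  by (rule finite_subset[OF _ finite_products[of n a' b]])
    (auto simp: products_of_bracket_def insert1_simps)

lemma coeff_bracket_LL_pure:
  "coeff (\<Sum>n\<le>degree (B (a' \<otimes> b)). \<Sum>k\<le>n.
        monom (scale3 (of_nat (n choose k))
                 (insert1 (coeff (B (a' \<otimes> b)) n) ((D ^^ k) a''))) (n - k)) m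
    = Sum_any (\<lambda>k. scale3 (of_nat (m + k choose k))
        (insert1 (coeff (B (a' \<otimes> b)) (m + k)) ((D ^^ k) a'')))"
  by (rule coeff_sum_monom_diff) (simp add: coeff_eq_0 insert1_simps)

text \<open>The summation bound depends on \<open>a'\<close>, which hides additivity. On
  coefficients the bound is gone, and every term of the remaining finitely supported sum is
  bilinear.\<close>

lemma bilinear_bracket_LL:
  "bilinear_map scale scale scale3_poly (\<lambda>a' a''.
     (\<Sum>n\<le>degree (B (a' \<otimes> b)). \<Sum>k\<le>n.
        monom (scale3 (of_nat (n choose k))
                 (insert1 (coeff (B (a' \<otimes> b)) n) ((D ^^ k) a''))) (n - k)))"
proof (intro bilinear_map_poly spaces)
  note D_power = linear_addD[OF linear_funpow[OF linear_D]]
    linear_scaleD[OF linear_funpow[OF linear_D]]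
  show "bilinear_map scale scale scale3 (\<lambda>a' a''.
      coeff (\<Sum>n\<le>degree (B (a' \<otimes> b)). \<Sum>k\<le>n.
        monom (scale3 (of_nat (n choose k))
                 (insert1 (coeff (B (a' \<otimes> b)) n) ((D ^^ k) a''))) (n - k)) m)" for m
    unfolding coeff_bracket_LL_pure
    by (intro bilinear_map_Sum_any finite_insert1_coeff bilinear_mapI spaces)
      (simp_all add: insert1_simps coeff_B_simps D_power T3.T.scale_right_distrib mult.commute)
qed

text \<open>Taking a scaled coefficient is linear and so passes through the lift, which leaves only
  pure tensors to check.\<close>

lemma scaled_coeff_lift3_poly:
  assumes "bilinear_map scale scale scale3_poly f"
    and "\<And>x y. scale3 (fact m) (coeff (f x y) m) = g x y"
  shows "scale3 (fact m) (coeff (lift3_poly f d) m) = lift3 g d"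
  using T2.linear_comp_tensor_lift[OF assms(1) linear_comp[OF linear_coeff3 linear_scale3]]
  by (simp add: assms(2))

lemma product_L_eq: "product_L P m a d = scale3 (fact m) (coeff (bracket_L B a d) m)"
  unfolding product_L_def bracket_L_def
  by (rule scaled_coeff_lift3_poly[symmetric, OF bilinear_bracket_L])
    (simp add: coeff_map_poly tens3_simps products_of_bracket_def)

lemma product_R_eq: "product_R P m a d = scale3 (fact m) (coeff (bracket_R B a d) m)"
  unfolding product_R_def bracket_R_def
  by (rule scaled_coeff_lift3_poly[symmetric, OF bilinear_bracket_R])
    (simp add: coeff_map_poly tens_left_simps products_of_bracket_def)

lemma product_LL_eq: "product_LL P m d b = scale3 (fact m) (coeff (bracket_LL B d b) m)"
  unfolding product_LL_def bracket_LL_def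
proof (rule scaled_coeff_lift3_poly[symmetric, OF bilinear_bracket_LL])
  fix a' a''
  show "scale3 (fact m) (coeff (\<Sum>n\<le>degree (B (a' \<otimes> b)). \<Sum>k\<le>n.
        monom (scale3 (of_nat (n choose k))
                 (insert1 (coeff (B (a' \<otimes> b)) n) ((D ^^ k) a''))) (n - k)) m)
    = Sum_any (\<lambda>j. scale3 (1 / fact j) (insert1 (P (m + j) a' b) ((D ^^ j) a'')))"
    unfolding coeff_bracket_LL_pure linear_Sum_any[OF linear_scale3 finite_insert1_coeff]
    by (simp add: fact_mult_binomial products_of_bracket_def insert1_simps)
qed

lemma linear_bracket_L: "Vector_Spaces.linear scale2 scale3_poly (bracket_L B a)"
  unfolding bracket_L_def [abs_def] by (intro T2.linear_tensor_lift spaces bilinear_bracket_L)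

lemma linear_bracket_R: "Vector_Spaces.linear scale2 scale3_poly (bracket_R B a)"
  unfolding bracket_R_def [abs_def] by (intro T2.linear_tensor_lift spaces bilinear_bracket_R)

lemma linear_bracket_LL: "Vector_Spaces.linear scale2 scale3_poly (\<lambda>d. bracket_LL B d b)"
  unfolding bracket_LL_def by (intro T2.linear_tensor_lift spaces bilinear_bracket_LL)

text \<open>The inner bracket carries \<mu> and the outer one \<lambda>, so only
  \<open>n = j\<close> contributes; j! normalises the inner product and i! the outer one. In
  \<open>jacobi_right_term\<close> the variables trade places.\<close>

lemma jacobi_left_term:
  "scale3 (fact i * fact j) (coeff (coeff (\<Sum>n\<le>degree (B (b \<otimes> c)).
      (mult_mu ^^ n) (subst_op mult_lambda (bracket_L B a (coeff (B (b \<otimes> c)) n)))) j) i)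
    = product_L P i a (P j b c)"
proof -
  have "coeff (coeff (\<Sum>n\<le>degree (B (b \<otimes> c)).
        (mult_mu ^^ n) (subst_op mult_lambda (bracket_L B a (coeff (B (b \<otimes> c)) n)))) j) i
      = (\<Sum>n\<le>degree (B (b \<otimes> c)).
          if n = j then coeff (bracket_L B a (coeff (B (b \<otimes> c)) n)) i else 0)"
    unfolding coeff_sum by (intro sum.cong) (auto simp: coeff_mult_mu_power coeff_subst_lambda)
  \<comment> \<open>If \<open>j\<close> exceeds the degree, the right side is a coefficient of the
    bracket with 0, hence 0 too.\<close>
  also have "\<dots> = coeff (bracket_L B a (coeff (B (b \<otimes> c)) j)) i"
    by (simp add: coeff_eq_0 linear_zeroD[OF linear_bracket_L])
  finally show ?thesis
    by (simp add: products_of_bracket_def linear_scaleD[OF linear_bracket_L] product_L_eq coeff_map_poly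
        mult.commute)
qed

lemma jacobi_right_term:
  "scale3 (fact i * fact j) (coeff (coeff (\<Sum>n\<le>degree (B (a \<otimes> c)).
      (mult_lambda ^^ n) (subst_op mult_mu (bracket_R B b (coeff (B (a \<otimes> c)) n)))) j) i)
    = product_R P j b (P i a c)"
proof -
  have "coeff (coeff (\<Sum>n\<le>degree (B (a \<otimes> c)).
        (mult_lambda ^^ n) (subst_op mult_mu (bracket_R B b (coeff (B (a \<otimes> c)) n)))) j) i
      = (\<Sum>n\<le>degree (B (a \<otimes> c)).
          if n = i then coeff (bracket_R B b (coeff (B (a \<otimes> c)) n)) j else 0)"
    unfolding coeff_sum by (intro sum.cong) (auto simp: coeff_mult_lambda_power coeff_subst_mu)
  also have "\<dots> = coeff (bracket_R B b (coeff (B (a \<otimes> c)) i)) j"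
    by (simp add: coeff_eq_0 linear_zeroD[OF linear_bracket_R])
  finally show ?thesis
    by (simp add: products_of_bracket_def linear_scaleD[OF linear_bracket_R] product_R_eq coeff_map_poly)
qed

text \<open>The inner bracket supplies \<lambda>^n, so \<lambda>^(i-n) \<mu>^j must come from the
  power \<open>i - n + j\<close> of \<lambda> + \<mu>, with coefficient
  \<open>(i - n + j) choose j\<close>.\<close>

lemma jacobi_outer_term:
  "scale3 (fact i * fact j) (coeff (coeff (\<Sum>n\<le>degree (B (a \<otimes> b)).
      (mult_lambda ^^ n)
        (subst_op (\<lambda>X. mult_lambda X + mult_mu X) (bracket_LL B (coeff (B (a \<otimes> b)) n) c))) j) i)
    = (\<Sum>n\<le>i. scale3 (of_nat (i choose n)) (product_LL P (i + j - n) (P n a b) c))"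
proof -
  let ?f = "\<lambda>n. scale3 (of_nat ((i - n + j) choose j))
    (coeff (bracket_LL B (coeff (B (a \<otimes> b)) n) c) (i - n + j))"
  have "coeff (coeff (\<Sum>n\<le>degree (B (a \<otimes> b)). (mult_lambda ^^ n)
        (subst_op (\<lambda>X. mult_lambda X + mult_mu X) (bracket_LL B (coeff (B (a \<otimes> b)) n) c))) j) i
      = (\<Sum>n\<le>degree (B (a \<otimes> b)). if i < n then 0 else ?f n)"
    unfolding coeff_sum coeff_mult_lambda_power coeff_subst_lambda_mu ..
  \<comment> \<open>Summands with \<open>n > i\<close> are 0 by the case split and those beyond the
    degree are brackets of 0, so the range may be cut and then extended to
    \<open>n \<le> i\<close>.\<close>
  also have "\<dots> = (\<Sum>n\<in>{..degree (B (a \<otimes> b))} \<inter> {..i}. ?f n)"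
    by (rule sum.mono_neutral_cong_right) auto
  also have "\<dots> = (\<Sum>n\<le>i. ?f n)"
    by (rule sum.mono_neutral_left) (auto simp: coeff_eq_0 linear_zeroD[OF linear_bracket_LL])
  finally have "coeff (coeff (\<Sum>n\<le>degree (B (a \<otimes> b)). (mult_lambda ^^ n)
        (subst_op (\<lambda>X. mult_lambda X + mult_mu X) (bracket_LL B (coeff (B (a \<otimes> b)) n) c))) j) i
      = (\<Sum>n\<le>i. ?f n)" .
  moreover have "scale3 (fact i * fact j) (?f n)
      = scale3 (of_nat (i choose n)) (product_LL P (i + j - n) (P n a b) c)" if "n \<le> i" for n
  proof -
    have "fact j * of_nat ((i - n + j) choose j) = (fact (i - n + j) / fact (i - n) :: 'k)"
      using fact_mult_binomial[of j "i - n"] binomial_symmetric[of j "i - n + j"]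
      by (simp add: add.commute)
    moreover have "of_nat (i choose n) * fact n = (fact i / fact (i - n) :: 'k)"
      using that by (simp add: binomial_fact)
    \<comment> \<open>On the right, n! is the normalisation of \<open>P n a b\<close> and (i - n +
      j)! that of the outer product.\<close>
    ultimately have "fact i * fact j * of_nat ((i - n + j) choose j)
        = (of_nat (i choose n) * (fact n * fact (i - n + j)) :: 'k)"
      by (simp add: mult.assoc[symmetric]) (simp add: mult.assoc)
    moreover have "i + j - n = i - n + j" using that by simp
    ultimately show ?thesis
      by (simp add: products_of_bracket_def linear_scaleD[OF linear_bracket_LL] product_LL_eq coeff_map_poly)
  qed
  ultimately show ?thesis by (simp add: T3.T.scale_sum_right)
qed

lemma jacobi_iff:
  "(\<forall>a b c. double_jacobi B a b c) \<longleftrightarrow>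
    (\<forall>m n a b c.
        product_L P m a (P n b c) - product_R P n b (P m a c)
        = (\<Sum>i\<le>m. scale3 (of_nat (m choose i)) (product_LL P (m + n - i) (P i a b) c)))"
  unfolding double_jacobi_def poly_poly_eq_iff_scaled coeff_diff T3.T.scale_right_diff_distrib
    jacobi_left_term jacobi_right_term jacobi_outer_term
  by (simp add: diff_eq_eq) blast

text \<open>The remaining axioms match one by one, in a different order. Linearity of
  \<open>B\<close> corresponds to bilinearity and eventual vanishing of the products, which hold for
  every linear \<open>B\<close>.\<close>

lemma double_lambda_bracket_iff: "double_lambda_bracket B \<longleftrightarrow> double_products P"
proof -
  have prems: "\<forall>n. bilinear_map scale scale scale2 (P n)" "\<forall>a b. \<exists>N. \<forall>n\<ge>N. P n a b = 0"
    using bilinear_products products_eventually_zero by simp_all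
  show ?thesis
    unfolding double_lambda_bracket_def double_products_def
    sesquilinear_left_iff sesquilinear_right_iff leibniz_right_iff leibniz_left_iff
    skewsymmetry_iff jacobi_iff
    by (insert linear_B prems, intro iffI; elim conjE; intro conjI; assumption)
qed

text \<open>By uniqueness of lifts only pure tensors matter; there 1/n! cancels n! and the
  polynomial is the sum of its monomials.\<close>

lemma bracket_of_products_of_bracket: "bracket_of_products P = B"
proof -
  have "B (a \<otimes> b) = generating_poly P a b" for a b
  proof -
    have "Sum_any (\<lambda>n. monom (scale2 (1 / fact n) (P n a b)) n)
        = (\<Sum>n\<le>degree (B (a \<otimes> b)). monom (scale2 (1 / fact n) (P n a b)) n)"
      by (rule Sum_any.expand_superset)
        (auto simp: products_of_bracket_def intro: ccontr dest!: le_degree)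
    then show ?thesis
      by (simp add: generating_poly_def products_of_bracket_def poly_as_sum_of_monoms)
  qed
  then show ?thesis
    unfolding bracket_of_products_def by (intro T2.tensor_lift_unique linear_B)
qed

end

section \<open>Recovering a bracket from its products\<close>

context
  fixes Q :: "nat \<Rightarrow> 'v \<Rightarrow> 'v \<Rightarrow> 't2"
  assumes bilinear_Q: "\<And>n. bilinear_map scale scale scale2 (Q n)"
    and eventually_zero_Q: "\<And>a b. \<exists>N. \<forall>n\<ge>N. Q n a b = 0"
begin

text \<open>Eventual vanishing makes the generating series a finite sum, so its coefficients can be
  read off.\<close>

lemma coeff_generating_poly:
  "coeff (generating_poly Q a b) n = scale2 (1 / fact n) (Q n a b)"
proof -
  obtain N where N: "\<forall>n\<ge>N. Q n a b = 0" using eventually_zero_Q by blast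
  have "generating_poly Q a b = (\<Sum>n<N. monom (scale2 (1 / fact n) (Q n a b)) n)"
    unfolding generating_poly_def
    by (rule Sum_any.expand_superset) (use N not_le in \<open>auto intro: ccontr\<close>)
  then show ?thesis using N by (simp add: coeff_sum not_less)
qed

lemma bilinear_generating_poly: "bilinear_map scale scale scale2_poly (generating_poly Q)"
  by (intro bilinear_map_poly spaces)
    (simp add: coeff_generating_poly bilinear_map_linear_comp[OF bilinear_Q linear_scale2])

lemma linear_bracket_of_products:
  "Vector_Spaces.linear scale2 scale2_poly (bracket_of_products Q)"
  unfolding bracket_of_products_def
  by (intro T2.linear_tensor_lift spaces bilinear_generating_poly)

lemma bracket_of_products_tens: "bracket_of_products Q (a \<otimes> b) = generating_poly Q a b"
  unfolding bracket_of_products_def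
  by (intro T2.tensor_lift_tens spaces bilinear_generating_poly)

lemma products_of_bracket_of_products: "products_of_bracket (bracket_of_products Q) = Q"
  by (simp add: products_of_bracket_def bracket_of_products_tens coeff_generating_poly fun_eq_iff)

end

lemma linear_double_lambda_bracket:
  "double_lambda_bracket B \<Longrightarrow> Vector_Spaces.linear scale2 scale2_poly B"
  by (simp add: double_lambda_bracket_def)

lemma double_products_of_bracket:
  "double_lambda_bracket B \<Longrightarrow> double_products (products_of_bracket B)"
  by (frule linear_double_lambda_bracket) (simp add: double_lambda_bracket_iff)

text \<open>The bracket built from \<open>Q\<close> is linear, so the equivalence of axioms applies
  to it, and its products are \<open>Q\<close> again.\<close>

lemma
  assumes "double_products Q"
  shows products_of_bracket_of_double_products: "products_of_bracket (bracket_of_products Q) = Q"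
    and bracket_of_double_products_tens: "bracket_of_products Q (a \<otimes> b) = generating_poly Q a b"
    and double_lambda_bracket_of_products: "double_lambda_bracket (bracket_of_products Q)"
proof -
  note axioms = double_products_def[THEN iffD1, OF assms]
  \<comment> \<open>Bilinearity and eventual vanishing, the two facts under which
    \<open>bracket_of_products Q\<close> is a well-defined lift.\<close>
  note Q = axioms[THEN conjunct1, THEN spec] axioms[THEN conjunct2, THEN conjunct1, THEN spec, THEN spec]
  show inverse: "products_of_bracket (bracket_of_products Q) = Q"
    by (rule products_of_bracket_of_products[OF Q])
  show "bracket_of_products Q (a \<otimes> b) = generating_poly Q a b"
    by (rule bracket_of_products_tens[OF Q])
  show "double_lambda_bracket (bracket_of_products Q)"
    unfolding double_lambda_bracket_iff[OF linear_bracket_of_products[OF Q]] inverse by fact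
qed

end

section \<open>The mutually inverse bijections\<close>

theorem proposition3p4:
  fixes scale :: "'k::field_char_0 \<Rightarrow> 'v::{ring,monoid_mult} \<Rightarrow> 'v"
    and D :: "'v \<Rightarrow> 'v"
    and scale2 :: "'k \<Rightarrow> 't2::ab_group_add \<Rightarrow> 't2"
    and tens :: "'v \<Rightarrow> 'v \<Rightarrow> 't2"
    and scale3 :: "'k \<Rightarrow> 't3::ab_group_add \<Rightarrow> 't3"
    and tens3 :: "'t2 \<Rightarrow> 'v \<Rightarrow> 't3"
  assumes "differential_algebra scale D"
    and "tensor_product scale scale scale2 tens"
    and "tensor_product scale2 scale scale3 tens3"
  shows
    "let brackets = Collect (differential_algebra_tensors.double_lambda_bracket
                               D scale2 tens scale3 tens3);
         products = Collect (differential_algebra_tensors.double_products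
                               scale D scale2 tens scale3 tens3);
         to_products = differential_algebra_tensors.products_of_bracket scale2 tens;
         to_bracket = differential_algebra_tensors.bracket_of_products scale2 tens
     in bij_betw to_products brackets products
      \<and> bij_betw to_bracket products brackets
      \<and> (\<forall>B\<in>brackets. to_bracket (to_products B) = B)
      \<and> (\<forall>P\<in>products. to_products (to_bracket P) = P)
      \<and> (\<forall>P\<in>products. \<forall>a b. to_bracket P (tens a b)
            = Sum_any (\<lambda>n. monom (scale2 (1 / fact n) (P n a b)) n))"
proof -
  interpret differential_algebra_tensors scale D scale2 tens scale3 tens3
    using assms by (simp add: differential_algebra_tensors_def)
  have BP: "bracket_of_products (products_of_bracket B) = B" if "double_lambda_bracket B" for B
    using that by (intro bracket_of_products_of_bracket linear_double_lambda_bracket)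
  show ?thesis
    unfolding Let_def
    \<comment> \<open>Each of the two maps is the inverse witness for the other.\<close>
    by (intro conjI bij_betw_byWitness[where f' = bracket_of_products]
        bij_betw_byWitness[where f' = products_of_bracket])
      (auto simp: BP products_of_bracket_of_double_products bracket_of_double_products_tens
          generating_poly_def
        intro: double_products_of_bracket double_lambda_bracket_of_products)
qed

end
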